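(* Let $\mathcal{S}\in\mathbb{C}^{p\times q\times n}$, $\mathcal{T}\in\mathbb{C}^{p\times k\times n}$ and $\mathcal{U}\in\mathbb{C}^{k\times q\times n}$. Then: (i) $\mathscr{R}(\mathcal{S})\subseteq\mathscr{R}(\mathcal{T})$ if and only if $\mathcal{S}=\mathcal{T}*\mathcal{Z}$ for some $\mathcal{Z}\in\mathbb{C}^{k\times q\times n}$. (ii) $\mathscr{N}(\mathcal{S})\subseteq\mathscr{N}(\mathcal{U})$ if and only if $\mathcal{U}=\mathcal{Y}*\mathcal{S}$ for some $\mathcal{Y}\in\mathbb{C}^{k\times p\times n}$.
   Context: A third-order tensor $\mathcal{A}\in\mathbb{C}^{a\times b\times n}$ has frontal slices $A_1,\dots,A_n\in\mathbb{C}^{a\times b}$, $A_k=\mathcal{A}(:,:,k)$. $\mathrm{bcirc}(\mathcal{A})\in\mathbb{C}^{an\times bn}$ is the block circulant matrix whose $(i,j)$ block ($1\le i,j\le n$) is $A_{((i-j)\bmod n)+1}$. For $\mathcal{A}\in\mathbb{C}^{a\times b\times n}$ and $\mathcal{B}\in\mathbb{C}^{b\times c\times n}$, the $t$-product $\mathcal{A}*\mathcal{B}\in\mathbb{C}^{a\times c\times n}$ is the unique tensor with $\mathrm{bcirc}(\mathcal{A}*\mathcal{B})=\mathrm{bcirc}(\mathcal{A})\,\mathrm{bcirc}(\mathcal{B})$. The $t$-range space $\mathscr{R}(\mathcal{A})$ is the range (column space) of $\mathrm{bcirc}(\mathcal{A})$, and the $t$-null space $\mathscr{N}(\mathcal{A})$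 is the null space of $\mathrm{bcirc}(\mathcal{A})$. *)

theory Defs
  imports "Jordan_Normal_Form.VS_Connect" "Jordan_Normal_Form.Matrix_Kernel"
begin

text \<open>
  A tensor in $\mathbb{C}^{a \times b \times n}$ is the list of its $n$ frontal slices; the list
  element at position $k$ is the slice $A_{k+1}$. Since a list carries the slice format only if it
  is nonempty, all of this is meant for $n > 0$.
\<close>

definition carrier_tensor :: "nat \<Rightarrow> nat \<Rightarrow> nat \<Rightarrow> complex mat list set" where
  "carrier_tensor a b n = {A. length A = n \<and> set A \<subseteq> carrier_mat a b}"

definition tensor_rows :: "complex mat list \<Rightarrow> nat" where
  "tensor_rows A = dim_row (hd A)"

definition tensor_cols :: "complex mat list \<Rightarrow> nat" where
  "tensor_cols A = dim_col (hd A)"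

text \<open>
  With 0-based indices, row $i$ lies in block row $i \mathbin{\mathrm{div}} a$, and the block with
  block indices $(I, J)$ is the slice at list position $(I - J) \bmod n$. The difference is taken
  in the integers, since subtraction of natural numbers truncates.
\<close>

definition bcirc :: "complex mat list \<Rightarrow> complex mat" where
  "bcirc A =
    (let a = tensor_rows A; b = tensor_cols A; n = length A
     in mat (a * n) (b * n) (\<lambda>(i, j).
          A ! nat ((int (i div a) - int (j div b)) mod int n) $$ (i mod a, j mod b)))"

definition tprod :: "complex mat list \<Rightarrow> complex mat list \<Rightarrow> complex mat list" (infixl "*\<^sub>t" 70) where
  "A *\<^sub>t B = (THE C. C \<in> carrier_tensor (tensor_rows A) (tensor_cols B) (length A) \<and>
                    bcirc C = bcirc A * bcirc B)"

definition t_range :: "complex mat list \<Rightarrow> complex vec set" where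
  "t_range A = vec_space.col_space (dim_row (bcirc A)) (bcirc A)"

definition t_null :: "complex mat list \<Rightarrow> complex vec set" where
  "t_null A = mat_kernel (bcirc A)"

lemma carrier_tensorD:
  assumes "A \<in> carrier_tensor a b n" "n > 0"
  shows "length A = n" "tensor_rows A = a" "tensor_cols A = b"
    "\<And>k. k < n \<Longrightarrow> A ! k \<in> carrier_mat a b"
proof -
  show len: "length A = n" using assms by (simp add: carrier_tensor_def)
  show nth: "A ! k \<in> carrier_mat a b" if "k < n" for k
    using assms that len by (auto simp: carrier_tensor_def subset_iff)
  have "hd A \<in> carrier_mat a b"
    using nth[of 0] assms(2) len by (cases A) auto
  thus "tensor_rows A = a" "tensor_cols A = b"
    by (auto simp: tensor_rows_def tensor_cols_def)
qed

lemma bcirc_carrier: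
  assumes "A \<in> carrier_tensor a b n" "n > 0"
  shows "bcirc A \<in> carrier_mat (a * n) (b * n)"
  using carrier_tensorD[OF assms] by (simp add: bcirc_def Let_def)

lemma bcirc_index:
  assumes A: "A \<in> carrier_tensor a b n" and n: "n > 0"
    and I: "I < n" "i < a" and J: "J < n" "j < b"
  shows "bcirc A $$ (I * a + i, J * b + j) = A ! nat ((int I - int J) mod int n) $$ (i, j)"
proof -
  have lt: "X * d + x < d * n" if "X < n" "x < d" for X x d :: nat
  proof -
    have "X * d + x < Suc X * d" using that by simp
    also have "\<dots> \<le> n * d" using that by (intro mult_le_mono) auto
    finally show ?thesis by (simp add: mult.commute)
  qed
  show ?thesis
    using lt[OF I] lt[OF J] I J carrier_tensorD[OF A n] by (simp add: bcirc_def Let_def)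
qed

lemma index_split:
  assumes "(i::nat) < a * n"
  obtains I r where "i = I * a + r" "I < n" "r < a"
proof
  have "a > 0" using assms by (cases a) auto
  show "i = (i div a) * a + i mod a" by simp
  show "i div a < n" using assms by (simp add: less_mult_imp_div_less mult.commute)
  show "i mod a < a" using \<open>a > 0\<close> by simp
qed

lemma bcirc_inj:
  assumes A: "A \<in> carrier_tensor a b n" and B: "B \<in> carrier_tensor a b n" and n: "n > 0"
    and eq: "bcirc A = bcirc B"
  shows "A = B"
proof (rule nth_equalityI)
  show "length A = length B"
    using carrier_tensorD[OF A n] carrier_tensorD[OF B n] by simp
  fix k assume "k < length A"
  hence k: "k < n" using carrier_tensorD[OF A n] by simp
  note cA = carrier_tensorD(4)[OF A n k] and cB = carrier_tensorD(4)[OF B n k]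
  show "A ! k = B ! k"
  proof (rule eq_matI)
    fix i j assume "i < dim_row (B ! k)" "j < dim_col (B ! k)"
    hence ij: "i < a" "j < b" using cB by auto
    show "A ! k $$ (i, j) = B ! k $$ (i, j)"
      using bcirc_index[OF A n k ij(1) n ij(2)] bcirc_index[OF B n k ij(1) n ij(2)] eq k
      by simp
  qed (use cA cB in auto)
qed

lemma sum_blocks:
  fixes f :: "nat \<Rightarrow> complex"
  shows "(\<Sum>l<b * n. f l) = (\<Sum>m<n. \<Sum>r<b. f (m * b + r))"
proof (induction n)
  case (Suc n)
  have "(\<Sum>l<b * Suc n. f l) = (\<Sum>l<b * n. f l) + (\<Sum>r<b. f (b * n + r))"
    using sum.atLeastLessThan_concat[of 0 "b * n" "b * n + b" f, symmetric]
      sum.shift_bounds_nat_ivl[of f 0 "b * n" b]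
    by (simp add: atLeast0LessThan add.commute)
  thus ?case using Suc by (simp add: mult.commute)
qed simp

lemma bcirc_mult_index:
  assumes A: "A \<in> carrier_tensor a b n" and B: "B \<in> carrier_tensor b c n" and n: "n > 0"
    and I: "I < n" "i < a" and J: "J < n" "j < c"
  shows "(bcirc A * bcirc B) $$ (I * a + i, J * c + j) =
    (\<Sum>m<n. \<Sum>r<b. A ! nat ((int I - int m) mod int n) $$ (i, r) *
                  B ! nat ((int m - int J) mod int n) $$ (r, j))"
proof -
  have lt: "X * d + x < d * n" if "X < n" "x < d" for X x d :: nat
  proof -
    have "X * d + x < Suc X * d" using that by simp
    also have "\<dots> \<le> n * d" using that by (intro mult_le_mono) auto
    finally show ?thesis by (simp add: mult.commute)
  qed
  have "(bcirc A * bcirc B) $$ (I * a + i, J * c + j) =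
      (\<Sum>l<b * n. bcirc A $$ (I * a + i, l) * bcirc B $$ (l, J * c + j))"
    using bcirc_carrier[OF A n] bcirc_carrier[OF B n] lt[OF I] lt[OF J]
    by (simp add: scalar_prod_def atLeast0LessThan)
  also have "\<dots> = (\<Sum>m<n. \<Sum>r<b. bcirc A $$ (I * a + i, m * b + r) * bcirc B $$ (m * b + r, J * c + j))"
    by (rule sum_blocks)
  also have "\<dots> = (\<Sum>m<n. \<Sum>r<b. A ! nat ((int I - int m) mod int n) $$ (i, r) *
                  B ! nat ((int m - int J) mod int n) $$ (r, j))"
    by (intro sum.cong refl) (simp add: bcirc_index[OF A n I] bcirc_index[OF B n _ _ J])
  finally show ?thesis .
qed

lemma sum_cyclic_shift:
  fixes g :: "nat \<Rightarrow> complex" and s :: int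
  assumes n: "n > 0"
  shows "(\<Sum>m<n. g (nat ((int m - s) mod int n))) = (\<Sum>m<n. g m)"
proof (rule sum.reindex_bij_witness[where i = "\<lambda>m. nat ((int m + s) mod int n)"
      and j = "\<lambda>m. nat ((int m - s) mod int n)"])
  fix m assume "m \<in> {..<n}"
  hence m: "m < n" by simp
  have nn: "int (nat (x mod int n)) = x mod int n" for x
    using n by simp
  show "nat ((int (nat ((int m - s) mod int n)) + s) mod int n) = m"
    unfolding nn using m by (simp add: mod_add_left_eq)
  show "nat ((int (nat ((int m + s) mod int n)) - s) mod int n) = m"
    unfolding nn using m by (simp add: mod_diff_left_eq)
  show "nat ((int m - s) mod int n) \<in> {..<n}" "nat ((int m + s) mod int n) \<in> {..<n}"
    using n by (auto simp: nat_less_iff)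
qed simp

text \<open>The $t$-product is well defined.\<close>

lemma tprod_ex1:
  assumes A: "A \<in> carrier_tensor a b n" and B: "B \<in> carrier_tensor b c n" and n: "n > 0"
  shows "\<exists>!C. C \<in> carrier_tensor a c n \<and> bcirc C = bcirc A * bcirc B"
proof (rule ex_ex1I)
  define C where "C = map (\<lambda>k. mat a c (\<lambda>(i, j). (bcirc A * bcirc B) $$ (k * a + i, j))) [0..<n]"
  have C: "C \<in> carrier_tensor a c n" by (auto simp: C_def carrier_tensor_def)
  have "bcirc C = bcirc A * bcirc B"
  proof (rule eq_matI)
    fix x y assume "x < dim_row (bcirc A * bcirc B)" "y < dim_col (bcirc A * bcirc B)"
    hence "x < a * n" "y < c * n"
      using bcirc_carrier[OF A n] bcirc_carrier[OF B n] by auto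
    then obtain I i J j where x: "x = I * a + i" "I < n" "i < a" and y: "y = J * c + j" "J < n" "j < c"
      by (metis index_split)
    define k where "k = nat ((int I - int J) mod int n)"
    have k: "k < n" and ik: "int k = (int I - int J) mod int n"
      using n by (auto simp: k_def nat_less_iff)
    define g where "g = (\<lambda>m. \<Sum>r<b. A ! nat ((int k - int m) mod int n) $$ (i, r) *
                                    B ! nat (int m mod int n) $$ (r, j))"
    have "bcirc C $$ (x, y) = (bcirc A * bcirc B) $$ (k * a + i, 0 * c + j)"
      unfolding x(1) y(1) bcirc_index[OF C n x(2,3) y(2,3)] k_def[symmetric]
      using k x y by (simp add: C_def)
    also have "\<dots> = (\<Sum>m<n. g m)"
      unfolding bcirc_mult_index[OF A B n k x(3) n y(3)] by (simp add: g_def)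
    also have "\<dots> = (\<Sum>m<n. g (nat ((int m - int J) mod int n)))"
      by (rule sum_cyclic_shift[OF n, symmetric])
    also have "\<dots> = (bcirc A * bcirc B) $$ (x, y)"
      unfolding x(1) y(1) bcirc_mult_index[OF A B n x(2,3) y(2,3)] g_def ik
      using n by (simp add: mod_diff_eq)
    finally show "bcirc C $$ (x, y) = (bcirc A * bcirc B) $$ (x, y)" .
  qed (use bcirc_carrier[OF A n] bcirc_carrier[OF B n] bcirc_carrier[OF C n] in auto)
  thus "\<exists>C. C \<in> carrier_tensor a c n \<and> bcirc C = bcirc A * bcirc B" using C by blast
qed (use bcirc_inj n in auto)

lemma tprod:
  assumes "A \<in> carrier_tensor a b n" "B \<in> carrier_tensor b c n" "n > 0"
  shows "A *\<^sub>t B \<in> carrier_tensor a c n" "bcirc (A *\<^sub>t B) = bcirc A * bcirc B"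
  using theI'[OF tprod_ex1[OF assms]] carrier_tensorD[OF assms(1,3)] carrier_tensorD[OF assms(2,3)]
  by (simp_all add: tprod_def)

end

theory Submission
  imports Defs
begin

text \<open>
  If \<open>bcirc\<close> is ignored, both parts are linear algebra over a field. A range inclusion
  says that every column of one matrix is a combination of the columns of another, which is a
  factorisation on the right. A kernel inclusion says that every row of \<open>U\<close>, read as a linear
  functional, vanishes on the common kernel of the rows of \<open>S\<close>; by
  \<open>functional_vanishing_on_common_kernel\<close> it is then a combination of those rows, which is a
  factorisation on the left.

  The matrix factor found in this way need not be block circulant. It can be replaced by one that
  is, because a block circulant matrix is determined by its first block column, and the first
  block column of a product \<open>bcirc T * M\<close> depends only on that of \<open>M\<close>. So the block circulant
  matrix with the first block column of \<open>M\<close> is as good a right factor as \<open>M\<close>, as the product of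
  block circulant matrices is again block circulant. Left factors are treated in the same way
  with first block rows.
\<close>

section \<open>Range and kernel inclusions of matrices\<close>

text \<open>
  Induction on the number of functionals. If the last functional \<open>R m\<close> does not already vanish on
  the common kernel \<open>K\<close> of the others, normalise \<open>x0\<close> in \<open>K\<close> with \<open>R m\<close> equal to 1 at \<open>x0\<close>.
  Every \<open>x\<close> in \<open>K\<close> can be moved along \<open>x0\<close> into the kernel of \<open>R m\<close>, so that \<open>u\<close> minus its value
  at \<open>x0\<close> times \<open>R m\<close> vanishes on all of \<open>K\<close>.
\<close>

lemma functional_vanishing_on_common_kernel:
  fixes u :: "'a :: field vec" and R :: "nat \<Rightarrow> 'a vec"
  assumes "u \<in> carrier_vec d" and "\<And>i. i < m \<Longrightarrow> R i \<in> carrier_vec d"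
    and "\<And>x. x \<in> carrier_vec d \<Longrightarrow> (\<And>i. i < m \<Longrightarrow> R i \<bullet> x = 0) \<Longrightarrow> u \<bullet> x = 0"
  shows "\<exists>c. \<forall>x \<in> carrier_vec d. u \<bullet> x = (\<Sum>i<m. c i * (R i \<bullet> x))"
  using assms
proof (induction m arbitrary: u)
  case 0
  thus ?case by auto
next
  case (Suc m)
  note u = Suc.prems(1) and R = Suc.prems(2) and van = Suc.prems(3)
  show ?case
  proof (cases "\<forall>x \<in> carrier_vec d. (\<forall>i<m. R i \<bullet> x = 0) \<longrightarrow> R m \<bullet> x = 0")
    case True
    have "u \<bullet> x = 0" if "x \<in> carrier_vec d" "\<And>i. i < m \<Longrightarrow> R i \<bullet> x = 0" for x
      using True that by (intro van) (auto simp: less_Suc_eq)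
    then obtain c where "\<forall>x \<in> carrier_vec d. u \<bullet> x = (\<Sum>i<m. c i * (R i \<bullet> x))"
      using Suc.IH[OF u] R by (meson less_SucI)
    thus ?thesis by (intro exI[of _ "c(m := 0)"]) simp
  next
    case False
    then obtain z where z: "z \<in> carrier_vec d" "\<And>i. i < m \<Longrightarrow> R i \<bullet> z = 0" "R m \<bullet> z \<noteq> 0"
      by auto
    define x0 where "x0 = inverse (R m \<bullet> z) \<cdot>\<^sub>v z"
    have Rm: "R m \<in> carrier_vec d" using R by simp
    have x0: "x0 \<in> carrier_vec d" "\<And>i. i < m \<Longrightarrow> R i \<bullet> x0 = 0" "R m \<bullet> x0 = 1"
      using z R Rm unfolding x0_def by (auto simp: scalar_prod_smult_distrib[where n = d])
    define v where "v = u - (u \<bullet> x0) \<cdot>\<^sub>v R m"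
    have v: "v \<in> carrier_vec d" using u Rm by (simp add: v_def)
    have v_app: "v \<bullet> x = u \<bullet> x - (u \<bullet> x0) * (R m \<bullet> x)" if "x \<in> carrier_vec d" for x
      using u Rm that unfolding v_def by (simp add: minus_scalar_prod_distrib[where n = d])
    have "v \<bullet> x = 0" if x: "x \<in> carrier_vec d" and K: "\<And>i. i < m \<Longrightarrow> R i \<bullet> x = 0" for x
    proof -
      define y where "y = x - (R m \<bullet> x) \<cdot>\<^sub>v x0"
      have y_app: "w \<bullet> y = w \<bullet> x - (R m \<bullet> x) * (w \<bullet> x0)" if "w \<in> carrier_vec d" for w
        using that x x0(1) unfolding y_def
        by (simp add: scalar_prod_minus_distrib[where n = d] scalar_prod_smult_distrib[where n = d])
      have "R i \<bullet> y = 0" if "i < Suc m" for i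
        using that K x0 y_app[OF R[OF that]] by (auto simp: less_Suc_eq)
      moreover have "y \<in> carrier_vec d" using x x0(1) by (simp add: y_def)
      ultimately have "u \<bullet> y = 0" by (intro van)
      thus ?thesis using y_app[OF u] v_app[OF x] by (simp add: mult.commute)
    qed
    then obtain c where c: "\<forall>x \<in> carrier_vec d. v \<bullet> x = (\<Sum>i<m. c i * (R i \<bullet> x))"
      using Suc.IH[OF v] R by (meson less_SucI)
    have "u \<bullet> x = (\<Sum>i<Suc m. (c(m := u \<bullet> x0)) i * (R i \<bullet> x))" if x: "x \<in> carrier_vec d" for x
    proof -
      have "u \<bullet> x = v \<bullet> x + (u \<bullet> x0) * (R m \<bullet> x)"
        using v_app[OF x] by simp
      thus ?thesis using c x by simp
    qed
    thus ?thesis by blast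
  qed
qed

lemma mat_kernel_subset_iff_left_factor:
  fixes A B :: "'a :: field mat"
  assumes A: "A \<in> carrier_mat m d" and B: "B \<in> carrier_mat l d"
  shows "mat_kernel A \<subseteq> mat_kernel B \<longleftrightarrow> (\<exists>M \<in> carrier_mat l m. B = M * A)"
proof
  assume sub: "mat_kernel A \<subseteq> mat_kernel B"
  have "\<exists>c. \<forall>x \<in> carrier_vec d. row B i \<bullet> x = (\<Sum>j<m. c j * (row A j \<bullet> x))" if i: "i < l" for i
  proof (rule functional_vanishing_on_common_kernel)
    fix x :: "'a vec" assume x: "x \<in> carrier_vec d" and 0: "\<And>j. j < m \<Longrightarrow> row A j \<bullet> x = 0"
    have "A *\<^sub>v x = 0\<^sub>v m" using A 0 by (intro eq_vecI) auto
    hence "B *\<^sub>v x = 0\<^sub>v l"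
      using sub mat_kernelI[OF A x] mat_kernelD(2)[OF B] by blast
    hence "(B *\<^sub>v x) $ i = 0" using i by simp
    thus "row B i \<bullet> x = 0" using B i by simp
  qed (use A B i in auto)
  then obtain c where
    c: "\<And>i x. i < l \<Longrightarrow> x \<in> carrier_vec d \<Longrightarrow> row B i \<bullet> x = (\<Sum>j<m. c i j * (row A j \<bullet> x))"
    by metis
  define M where "M = mat l m (\<lambda>(i, j). c i j)"
  have "B = M * A"
  proof (rule eq_matI)
    fix i j assume "i < dim_row (M * A)" "j < dim_col (M * A)"
    hence ij: "i < l" "j < d" using A by (auto simp: M_def)
    have ent: "C $$ (h, j) = row C h \<bullet> unit_vec d j" if "C \<in> carrier_mat e d" "h < e" for C :: "'a mat" and h e
      using that ij(2) by (simp add: scalar_prod_right_unit[where n = d])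
    have "B $$ (i, j) = (\<Sum>h<m. c i h * A $$ (h, j))"
      unfolding ent[OF B ij(1)] by (simp add: c ij(1) ent[OF A])
    thus "B $$ (i, j) = (M * A) $$ (i, j)"
      using A ij by (simp add: M_def scalar_prod_def atLeast0LessThan)
  qed (use A B in \<open>auto simp: M_def\<close>)
  thus "\<exists>M \<in> carrier_mat l m. B = M * A" by (auto simp: M_def)
next
  assume "\<exists>M \<in> carrier_mat l m. B = M * A"
  then obtain M where M: "M \<in> carrier_mat l m" "B = M * A" by blast
  show "mat_kernel A \<subseteq> mat_kernel B"
  proof
    fix x assume "x \<in> mat_kernel A"
    hence x: "x \<in> carrier_vec d" "A *\<^sub>v x = 0\<^sub>v m" using mat_kernelD[OF A] by auto
    hence "B *\<^sub>v x = 0\<^sub>v l" using M A by (auto simp: assoc_mult_mat_vec)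
    thus "x \<in> mat_kernel B" using mat_kernelI[OF B x(1)] by simp
  qed
qed

lemma col_space_subset_iff_right_factor:
  fixes A B :: "'a :: field mat"
  assumes A: "A \<in> carrier_mat m d" and B: "B \<in> carrier_mat m l"
  shows "vec_space.col_space m A \<subseteq> vec_space.col_space m B \<longleftrightarrow> (\<exists>M \<in> carrier_mat l d. A = B * M)"
proof -
  have range: "vec_space.col_space m C = {y \<in> carrier_vec m. \<exists>x \<in> carrier_vec e. C *\<^sub>v x = y}"
    if "C \<in> carrier_mat m e" for C :: "'a mat" and e
    using vec_space.col_space_eq[OF that] that by auto
  show ?thesis
  proof
    assume sub: "vec_space.col_space m A \<subseteq> vec_space.col_space m B"
    have "\<exists>x \<in> carrier_vec l. B *\<^sub>v x = col A j" if "j < d" for j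
    proof -
      have "A *\<^sub>v unit_vec d j = col A j"
        using A that by (intro eq_vecI) (auto simp: scalar_prod_right_unit[where n = d])
      moreover have "unit_vec d j \<in> carrier_vec d" by simp
      ultimately have "col A j \<in> vec_space.col_space m A"
        unfolding range[OF A] using A that by auto
      thus ?thesis using sub unfolding range[OF B] by auto
    qed
    then obtain f where f: "\<And>j. j < d \<Longrightarrow> f j \<in> carrier_vec l \<and> B *\<^sub>v f j = col A j" by metis
    define M where "M = mat_of_cols l (map f [0..<d])"
    have M: "M \<in> carrier_mat l d" by (simp add: M_def carrier_matI)
    have "A = B * M"
    proof (rule mat_col_eqI)
      fix j assume "j < dim_col (B * M)"
      hence j: "j < d" using M by simp
      have "col M j = f j" using j f by (simp add: M_def)
      thus "col A j = col (B * M) j"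
        using f[OF j] col_mult2[OF B M j] by simp
    qed (use A B M in auto)
    thus "\<exists>M \<in> carrier_mat l d. A = B * M" using M by blast
  next
    assume "\<exists>M \<in> carrier_mat l d. A = B * M"
    then obtain M where M: "M \<in> carrier_mat l d" "A = B * M" by blast
    show "vec_space.col_space m A \<subseteq> vec_space.col_space m B"
    proof
      fix y assume "y \<in> vec_space.col_space m A"
      then obtain x where "y \<in> carrier_vec m" "x \<in> carrier_vec d" "A *\<^sub>v x = y"
        unfolding range[OF A] by auto
      moreover from this have "B *\<^sub>v (M *\<^sub>v x) = y" using M B by (simp add: assoc_mult_mat_vec)
      ultimately show "y \<in> vec_space.col_space m B"
        unfolding range[OF B] using M(1) by (auto intro!: bexI[of _ "M *\<^sub>v x"])
    qed
  qed
qed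

section \<open>Block circulant factors\<close>

lemma bcirc_first_block_col_inj:
  assumes A: "A \<in> carrier_tensor a b n" and B: "B \<in> carrier_tensor a b n" and n: "n > 0"
    and eq: "\<And>x j. x < a * n \<Longrightarrow> j < b \<Longrightarrow> bcirc A $$ (x, j) = bcirc B $$ (x, j)"
  shows "A = B"
proof (rule nth_equalityI)
  show "length A = length B" using carrier_tensorD(1)[OF A n] carrier_tensorD(1)[OF B n] by simp
  fix k assume "k < length A"
  hence k: "k < n" using carrier_tensorD(1)[OF A n] by simp
  note cA = carrier_tensorD(4)[OF A n k] and cB = carrier_tensorD(4)[OF B n k]
  show "A ! k = B ! k"
  proof (rule eq_matI)
    fix i j assume "i < dim_row (B ! k)" "j < dim_col (B ! k)"
    hence ij: "i < a" "j < b" using cB by auto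
    have "k * a + i < Suc k * a" using ij by simp
    also have "\<dots> \<le> a * n" using k by (metis Suc_leI mult.commute mult_le_mono1)
    finally show "A ! k $$ (i, j) = B ! k $$ (i, j)"
      using eq[of "k * a + i" j] ij k
        bcirc_index[OF A n k ij(1) n ij(2)] bcirc_index[OF B n k ij(1) n ij(2)] by simp
  qed (use cA cB in auto)
qed

text \<open>In the first block row, slice \<open>k\<close> is the block in block column \<open>- k mod n\<close>.\<close>

lemma bcirc_first_block_row_inj:
  assumes A: "A \<in> carrier_tensor a b n" and B: "B \<in> carrier_tensor a b n" and n: "n > 0"
    and eq: "\<And>i y. i < a \<Longrightarrow> y < b * n \<Longrightarrow> bcirc A $$ (i, y) = bcirc B $$ (i, y)"
  shows "A = B"
proof (rule nth_equalityI)
  show "length A = length B" using carrier_tensorD(1)[OF A n] carrier_tensorD(1)[OF B n] by simp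
  fix k assume "k < length A"
  hence k: "k < n" using carrier_tensorD(1)[OF A n] by simp
  define J where "J = nat ((- int k) mod int n)"
  have J: "J < n" and Jk: "nat ((- int J) mod int n) = k"
    using n k by (auto simp: J_def nat_less_iff mod_minus_eq)
  note cA = carrier_tensorD(4)[OF A n k] and cB = carrier_tensorD(4)[OF B n k]
  show "A ! k = B ! k"
  proof (rule eq_matI)
    fix i j assume "i < dim_row (B ! k)" "j < dim_col (B ! k)"
    hence ij: "i < a" "j < b" using cB by auto
    have "J * b + j < Suc J * b" using ij by simp
    also have "\<dots> \<le> b * n" using J by (metis Suc_leI mult.commute mult_le_mono1)
    finally show "A ! k $$ (i, j) = B ! k $$ (i, j)"
      using eq[of i "J * b + j"] ij Jk
        bcirc_index[OF A n n ij(1) J ij(2)] bcirc_index[OF B n n ij(1) J ij(2)] by simp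
  qed (use cA cB in auto)
qed

lemma ex_bcirc_first_block_col:
  assumes n: "n > 0"
  shows "\<exists>Z \<in> carrier_tensor a b n. \<forall>x < a * n. \<forall>j < b. bcirc Z $$ (x, j) = M $$ (x, j)"
proof -
  define Z where "Z = map (\<lambda>k. mat a b (\<lambda>(i, j). M $$ (k * a + i, j))) [0..<n]"
  have Z: "Z \<in> carrier_tensor a b n" by (auto simp: Z_def carrier_tensor_def)
  have "bcirc Z $$ (x, j) = M $$ (x, j)" if x: "x < a * n" and j: "j < b" for x j
  proof -
    obtain I i where I: "x = I * a + i" "I < n" "i < a" using x by (rule index_split)
    show ?thesis
      using bcirc_index[OF Z n I(2,3) n j] I j by (simp add: Z_def)
  qed
  thus ?thesis using Z by blast
qed

lemma ex_bcirc_first_block_row: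
  assumes n: "n > 0"
  shows "\<exists>Y \<in> carrier_tensor a b n. \<forall>i < a. \<forall>y < b * n. bcirc Y $$ (i, y) = M $$ (i, y)"
proof -
  define Y where
    "Y = map (\<lambda>k. mat a b (\<lambda>(i, j). M $$ (i, nat ((- int k) mod int n) * b + j))) [0..<n]"
  have Y: "Y \<in> carrier_tensor a b n" by (auto simp: Y_def carrier_tensor_def)
  have "bcirc Y $$ (i, y) = M $$ (i, y)" if i: "i < a" and y: "y < b * n" for i y
  proof -
    obtain J j where J: "y = J * b + j" "J < n" "j < b" using y by (rule index_split)
    define k where "k = nat ((- int J) mod int n)"
    have "k < n" "nat ((- int k) mod int n) = J"
      using n J(2) by (auto simp: k_def nat_less_iff mod_minus_eq)
    thus ?thesis
      using bcirc_index[OF Y n n i J(2,3)] i J by (simp add: Y_def k_def[symmetric])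
  qed
  thus ?thesis using Y by blast
qed

text \<open>
  Only the first block column of \<open>M\<close> enters the first block column of \<open>bcirc T * M\<close>, so \<open>M\<close> may be
  replaced by the block circulant matrix that shares this block column.
\<close>

lemma right_factor_bcirc_iff_tprod:
  assumes n: "n > 0" and S: "S \<in> carrier_tensor p q n" and T: "T \<in> carrier_tensor p k n"
  shows "(\<exists>M \<in> carrier_mat (k * n) (q * n). bcirc S = bcirc T * M) \<longleftrightarrow>
    (\<exists>Z \<in> carrier_tensor k q n. S = T *\<^sub>t Z)"
proof
  assume "\<exists>M \<in> carrier_mat (k * n) (q * n). bcirc S = bcirc T * M"
  then obtain M where M: "M \<in> carrier_mat (k * n) (q * n)" "bcirc S = bcirc T * M" by blast
  obtain Z where Z: "Z \<in> carrier_tensor k q n"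
    and ZM: "\<forall>x < k * n. \<forall>j < q. bcirc Z $$ (x, j) = M $$ (x, j)"
    using ex_bcirc_first_block_col[OF n] by metis
  note P = tprod[OF T Z n]
  have "S = T *\<^sub>t Z"
  proof (rule bcirc_first_block_col_inj[OF S P(1) n])
    fix x j assume x: "x < p * n" and j: "j < q"
    have jn: "j < q * n" using j n by (cases n) auto
    have "col (bcirc Z) j = col M j"
      using ZM M(1) bcirc_carrier[OF Z n] j jn by (intro eq_vecI) auto
    thus "bcirc S $$ (x, j) = bcirc (T *\<^sub>t Z) $$ (x, j)"
      using M P(2) bcirc_carrier[OF T n] bcirc_carrier[OF Z n] x jn by simp
  qed
  thus "\<exists>Z \<in> carrier_tensor k q n. S = T *\<^sub>t Z" using Z by blast
next
  assume "\<exists>Z \<in> carrier_tensor k q n. S = T *\<^sub>t Z"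
  thus "\<exists>M \<in> carrier_mat (k * n) (q * n). bcirc S = bcirc T * M"
    using tprod(2)[OF T _ n] bcirc_carrier[OF _ n] by blast
qed

lemma left_factor_bcirc_iff_tprod:
  assumes n: "n > 0" and S: "S \<in> carrier_tensor p q n" and U: "U \<in> carrier_tensor k q n"
  shows "(\<exists>M \<in> carrier_mat (k * n) (p * n). bcirc U = M * bcirc S) \<longleftrightarrow>
    (\<exists>Y \<in> carrier_tensor k p n. U = Y *\<^sub>t S)"
proof
  assume "\<exists>M \<in> carrier_mat (k * n) (p * n). bcirc U = M * bcirc S"
  then obtain M where M: "M \<in> carrier_mat (k * n) (p * n)" "bcirc U = M * bcirc S" by blast
  obtain Y where Y: "Y \<in> carrier_tensor k p n"
    and YM: "\<forall>i < k. \<forall>y < p * n. bcirc Y $$ (i, y) = M $$ (i, y)"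
    using ex_bcirc_first_block_row[OF n] by metis
  note P = tprod[OF Y S n]
  have "U = Y *\<^sub>t S"
  proof (rule bcirc_first_block_row_inj[OF U P(1) n])
    fix i y assume i: "i < k" and y: "y < q * n"
    have i_n: "i < k * n" using i n by (cases n) auto
    have "row (bcirc Y) i = row M i"
      using YM M(1) bcirc_carrier[OF Y n] i i_n by (intro eq_vecI) auto
    thus "bcirc U $$ (i, y) = bcirc (Y *\<^sub>t S) $$ (i, y)"
      using M P(2) bcirc_carrier[OF S n] bcirc_carrier[OF Y n] y i_n by simp
  qed
  thus "\<exists>Y \<in> carrier_tensor k p n. U = Y *\<^sub>t S" using Y by blast
next
  assume "\<exists>Y \<in> carrier_tensor k p n. U = Y *\<^sub>t S"
  thus "\<exists>M \<in> carrier_mat (k * n) (p * n). bcirc U = M * bcirc S"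
    using tprod(2)[OF _ S n] bcirc_carrier[OF _ n] by blast
qed

section \<open>Range and null space inclusions of tensors\<close>

theorem proposition3p1:
  fixes S T U :: "complex mat list" and p q k n :: nat
  assumes "n > 0"
    and "S \<in> carrier_tensor p q n"
    and "T \<in> carrier_tensor p k n"
    and "U \<in> carrier_tensor k q n"
  shows "(t_range S \<subseteq> t_range T \<longleftrightarrow> (\<exists>Z \<in> carrier_tensor k q n. S = T *\<^sub>t Z)) \<and>
         (t_null S \<subseteq> t_null U \<longleftrightarrow> (\<exists>Y \<in> carrier_tensor k p n. U = Y *\<^sub>t S))"
proof -
  note S = bcirc_carrier[OF assms(2,1)] and T = bcirc_carrier[OF assms(3,1)]
    and U = bcirc_carrier[OF assms(4,1)]
  have "t_range S \<subseteq> t_range T \<longleftrightarrow> (\<exists>Z \<in> carrier_tensor k q n. S = T *\<^sub>t Z)"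
    using col_space_subset_iff_right_factor[OF S T] S T
      right_factor_bcirc_iff_tprod[OF assms(1,2,3)] by (simp add: t_range_def)
  moreover have "t_null S \<subseteq> t_null U \<longleftrightarrow> (\<exists>Y \<in> carrier_tensor k p n. U = Y *\<^sub>t S)"
    using mat_kernel_subset_iff_left_factor[OF S U]
      left_factor_bcirc_iff_tprod[OF assms(1,2,4)] by (simp add: t_null_def)
  ultimately show ?thesis by blast
qed

end
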